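(* Let $1\le p\le q<+\infty$. Let $E$ be a Banach space when $p=1$, and a normed space when $p>1$. Let $f\colon E\to E$ and assume that the composition operator $C_f$ maps $bv_p(E)$ into $bv_q(E)$. Then the following conditions are equivalent: (i) $C_f\colon bv_p(E)\to bv_q(E)$ is Lipschitz continuous; (ii) $C_f\colon bv_p(E)\to bv_q(E)$ is uniformly continuous; (iii) the map $\varphi\colon E\to E$, $\varphi(u):=f(u)-f(0)$, is a continuous $\mathbb R$-linear endomorphism of $E$.
   Context: $E$ is over $\mathbb R$ or $\mathbb C$ with norm $\|\cdot\|$. A map $T\colon E\to E$ is $\mathbb R$-linear if it is additive and $T(\lambda u)=\lambda T(u)$ for every $u\in E$ and $\lambda\in\mathbb R$ (also when $E$ is a complex space). For a map $f\colon E\to E$, the composition operator $C_f$ assigns to a sequence $x\colon\mathbb N\to E$ the sequence $C_f(x)$ with $C_f(x)(n)=f(x(n))$ for all $n\in\mathbb N$. For $p\in[1,+\infty)$, $bv_p(E)$ is the space of all sequences $x\colon\mathbb N\to E$ with $\sum_{n=1}^\infty\|x(n+1)-x(n)\|^p<+\infty$, with norm $\|x\|_{bv_p}=\|x(1)\|+\bigl(\sum_{n=1}^\infty\|x(n+1)-x(n)\|^p\bigr)^{1/p}$. *)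

theory Defs
  imports "HOL-Analysis.Analysis"
begin

(* Scalars: a complex normed space is used only through its underlying real normed space (norm,
   topology, real-linearity), so real_normed_vector covers both scalar fields.
   Indexing: sequences start at index 0, so x 0 is the first term. *)

definition bv :: "real \<Rightarrow> (nat \<Rightarrow> 'a::real_normed_vector) set" where
  "bv p = {x. summable (\<lambda>n. norm (x (Suc n) - x n) powr p)}"

definition bv_norm :: "real \<Rightarrow> (nat \<Rightarrow> 'a::real_normed_vector) \<Rightarrow> real" where
  "bv_norm p x = norm (x 0) + (\<Sum>n. norm (x (Suc n) - x n) powr p) powr (1 / p)"

definition bv_dist ::
    "real \<Rightarrow> (nat \<Rightarrow> 'a::real_normed_vector) \<Rightarrow> (nat \<Rightarrow> 'a) \<Rightarrow> real" where
  "bv_dist p x y = bv_norm p (\<lambda>n. x n - y n)"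

(* Meaningful only for p \<ge> 1; see Metric_space_bv, mspace_bv_metric and mdist_bv_metric below. *)
definition bv_metric :: "real \<Rightarrow> (nat \<Rightarrow> 'a::real_normed_vector) metric" where
  "bv_metric p = metric (bv p, bv_dist p)"

definition composition_operator :: "('a \<Rightarrow> 'a) \<Rightarrow> (nat \<Rightarrow> 'a) \<Rightarrow> (nat \<Rightarrow> 'a)" where
  "composition_operator f x = (\<lambda>n. f (x n))"

lemma powr_convex_combination:
  fixes a b p u v :: real
  assumes p: "1 \<le> p" and ab: "0 \<le> a" "0 \<le> b" and uv: "0 \<le> u" "0 \<le> v" "u + v = 1"
  shows "(u * a + v * b) powr p \<le> u * a powr p + v * b powr p"
proof -
  have shrink: "(t * c) powr p \<le> t * c powr p" if "0 \<le> t" "t \<le> 1" "0 \<le> c" for t c :: real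
  proof (cases "t = 0")
    case False
    then have "t powr p \<le> t powr 1"
      using that p by (intro powr_mono') auto
    then have "t powr p \<le> t"
      using that by simp
    then show ?thesis
      using that by (simp add: powr_mult mult_right_mono)
  qed simp
  consider "a = 0" | "b = 0" | "a > 0" "b > 0"
    using ab by linarith
  then show ?thesis
  proof cases
    case 1
    then show ?thesis using shrink[of v b] uv ab by simp
  next
    case 2
    then show ?thesis using shrink[of u a] uv ab by simp
  next
    case 3
    then show ?thesis
      using powr_convex[OF p] uv unfolding convex_on_def by auto
  qed
qed

lemma Minkowski_suminf:
  fixes a b :: "nat \<Rightarrow> real" and p :: real
  assumes p: "1 \<le> p"
    and a: "\<And>n. 0 \<le> a n" "summable (\<lambda>n. a n powr p)"
    and b: "\<And>n. 0 \<le> b n" "summable (\<lambda>n. b n powr p)"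
  shows "summable (\<lambda>n. (a n + b n) powr p)"
    and "(\<Sum>n. (a n + b n) powr p) powr (1 / p)
          \<le> (\<Sum>n. a n powr p) powr (1 / p) + (\<Sum>n. b n powr p) powr (1 / p)"
proof -
  define A where "A = (\<Sum>n. a n powr p) powr (1 / p)"
  define B where "B = (\<Sum>n. b n powr p) powr (1 / p)"
  have Ap: "A powr p = (\<Sum>n. a n powr p)" and Bp: "B powr p = (\<Sum>n. b n powr p)"
    using p by (auto simp: A_def B_def powr_powr suminf_nonneg a b)
  have "A \<ge> 0" "B \<ge> 0"
    by (auto simp: A_def B_def)
  have a0: "a n = 0" if "A = 0" for n
    using that Ap p suminf_eq_zero_iff[OF a(2)] by auto
  have b0: "b n = 0" if "B = 0" for n
    using that Bp p suminf_eq_zero_iff[OF b(2)] by auto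
  have "summable (\<lambda>n. (a n + b n) powr p) \<and> (\<Sum>n. (a n + b n) powr p) powr (1 / p) \<le> A + B"
  proof (cases "A = 0 \<or> B = 0")
    case True
    then show ?thesis
      using a0 b0 a b \<open>A \<ge> 0\<close> \<open>B \<ge> 0\<close> by (auto simp: A_def B_def)
  next
    case False
    then have pos: "A > 0" "B > 0" "A + B > 0"
      using \<open>A \<ge> 0\<close> \<open>B \<ge> 0\<close> by auto
    define c where "c n = (A + B) powr p *
        (A / (A + B) * (a n powr p / A powr p) + B / (A + B) * (b n powr p / B powr p))" for n
    have le: "(a n + b n) powr p \<le> c n" for n
    proof -
      have uv: "A / (A + B) + B / (A + B) = 1"
        using pos by (metis add_divide_distrib divide_self less_irrefl)
      have "a n + b n = (A + B) * (A / (A + B) * (a n / A) + B / (A + B) * (b n / B))"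
        using pos by (simp add: distrib_left)
      also have "\<dots> powr p =
          (A + B) powr p * (A / (A + B) * (a n / A) + B / (A + B) * (b n / B)) powr p"
        using pos a b by (simp add: powr_mult)
      also have "\<dots> \<le> (A + B) powr p *
          (A / (A + B) * (a n / A) powr p + B / (A + B) * (b n / B) powr p)"
        using pos a b uv by (intro mult_left_mono powr_convex_combination p) auto
      also have "\<dots> = c n"
        using pos a b by (simp add: c_def powr_divide)
      finally show ?thesis .
    qed
    have "(\<lambda>n. a n powr p) sums (A powr p)" "(\<lambda>n. b n powr p) sums (B powr p)"
      using a b by (simp_all add: Ap Bp summable_sums)
    then have "c sums ((A + B) powr p *
        (A / (A + B) * (A powr p / A powr p) + B / (A + B) * (B powr p / B powr p)))"
      unfolding c_def by (intro sums_mult sums_add sums_divide)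
    also have "(A + B) powr p *
        (A / (A + B) * (A powr p / A powr p) + B / (A + B) * (B powr p / B powr p))
        = (A + B) powr p"
      using pos by (simp flip: add_divide_distrib)
    finally have c: "c sums ((A + B) powr p)" .
    have S: "summable (\<lambda>n. (a n + b n) powr p)"
      using le by (intro summable_comparison_test'[OF sums_summable[OF c]]) auto
    have "(\<Sum>n. (a n + b n) powr p) \<le> (A + B) powr p"
      using suminf_le[OF le S sums_summable[OF c]] sums_unique[OF c] by simp
    then have "(\<Sum>n. (a n + b n) powr p) powr (1 / p) \<le> ((A + B) powr p) powr (1 / p)"
      using p S by (intro powr_mono2 suminf_nonneg) auto
    also have "\<dots> = A + B"
      using pos p by (simp add: powr_powr)
    finally show ?thesis
      using S by simp
  qed
  then show "summable (\<lambda>n. (a n + b n) powr p)"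
    and "(\<Sum>n. (a n + b n) powr p) powr (1 / p)
          \<le> (\<Sum>n. a n powr p) powr (1 / p) + (\<Sum>n. b n powr p) powr (1 / p)"
    by (auto simp: A_def B_def)
qed

lemma bv_add:
  assumes p: "1 \<le> p" and x: "x \<in> bv p" and y: "y \<in> bv p"
  shows "(\<lambda>n. x n + y n) \<in> bv p"
    and "bv_norm p (\<lambda>n. x n + y n) \<le> bv_norm p x + bv_norm p y"
proof -
  define a where "a n = norm (x (Suc n) - x n)" for n
  define b where "b n = norm (y (Suc n) - y n)" for n
  define s where "s n = norm (x (Suc n) + y (Suc n) - (x n + y n))" for n
  have sa: "summable (\<lambda>n. a n powr p)" and sb: "summable (\<lambda>n. b n powr p)"
    using x y by (auto simp: bv_def a_def b_def)
  note M = Minkowski_suminf[OF p _ sa _ sb]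
  have "s n \<le> a n + b n" for n
    unfolding s_def a_def b_def
    by (metis add_diff_add norm_triangle_ineq)
  then have le: "s n powr p \<le> (a n + b n) powr p" for n
    using p by (intro powr_mono2) (auto simp: s_def)
  have ab: "summable (\<lambda>n. (a n + b n) powr p)"
    by (rule M(1)) (auto simp: a_def b_def)
  have S: "summable (\<lambda>n. s n powr p)"
    using le by (intro summable_comparison_test'[OF ab]) auto
  then show "(\<lambda>n. x n + y n) \<in> bv p"
    by (simp add: bv_def s_def)
  have "(\<Sum>n. s n powr p) powr (1 / p) \<le> (\<Sum>n. (a n + b n) powr p) powr (1 / p)"
    using p suminf_le[OF le S ab] by (intro powr_mono2 suminf_nonneg[OF S]) auto
  also have "\<dots> \<le> (\<Sum>n. a n powr p) powr (1 / p) + (\<Sum>n. b n powr p) powr (1 / p)"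
    by (rule M(2)) (auto simp: a_def b_def)
  finally show "bv_norm p (\<lambda>n. x n + y n) \<le> bv_norm p x + bv_norm p y"
    using norm_triangle_ineq[of "x 0" "y 0"]
    by (simp add: bv_norm_def s_def a_def b_def)
qed

lemma bv_uminus: "x \<in> bv p \<Longrightarrow> (\<lambda>n. - x n) \<in> bv p"
  by (simp add: bv_def norm_minus_commute)

lemma bv_diff: "1 \<le> p \<Longrightarrow> x \<in> bv p \<Longrightarrow> y \<in> bv p \<Longrightarrow> (\<lambda>n. x n - y n) \<in> bv p"
  using bv_add(1)[OF _ _ bv_uminus, of p x y] by simp

lemma bv_dist_commute: "bv_dist p x y = bv_dist p y x"
proof -
  have "norm (x (Suc n) - y (Suc n) - (x n - y n)) = norm (y (Suc n) - x (Suc n) - (y n - x n))"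
    for n
    using norm_minus_commute[of "x (Suc n) - y (Suc n)" "x n - y n"]
    by (simp add: algebra_simps)
  then show ?thesis
    by (simp add: bv_dist_def bv_norm_def norm_minus_commute)
qed

lemma bv_norm_eq_0:
  assumes p: "1 \<le> p" and x: "x \<in> bv p"
  shows "bv_norm p x = 0 \<longleftrightarrow> (\<forall>n. x n = 0)"
proof
  assume "bv_norm p x = 0"
  then have x0: "x 0 = 0" and s: "(\<Sum>n. norm (x (Suc n) - x n) powr p) = 0"
    by (auto simp: bv_norm_def add_nonneg_eq_0_iff)
  have "summable (\<lambda>n. norm (x (Suc n) - x n) powr p)"
    using x by (simp add: bv_def)
  then have "x (Suc n) = x n" for n
    using s suminf_eq_zero_iff by fastforce
  then have "x n = 0" for n
    using x0 by (induction n) auto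
  then show "\<forall>n. x n = 0" ..
qed (use p in \<open>simp add: bv_norm_def\<close>)

lemma Metric_space_bv:
  assumes p: "1 \<le> p"
  shows "Metric_space (bv p) (bv_dist p)"
proof
  fix x y z :: "nat \<Rightarrow> 'a"
  show "0 \<le> bv_dist p x y"
    by (simp add: bv_dist_def bv_norm_def)
  show "bv_dist p x y = bv_dist p y x"
    by (rule bv_dist_commute)
  assume x: "x \<in> bv p" and y: "y \<in> bv p"
  show "bv_dist p x y = 0 \<longleftrightarrow> x = y"
    using bv_norm_eq_0[OF p bv_diff[OF p x y]] by (auto simp: bv_dist_def)
  assume z: "z \<in> bv p"
  show "bv_dist p x z \<le> bv_dist p x y + bv_dist p y z"
    using bv_add(2)[OF p bv_diff[OF p x y] bv_diff[OF p y z]] by (simp add: bv_dist_def)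
qed

lemma mspace_bv_metric: "1 \<le> p \<Longrightarrow> mspace (bv_metric p) = bv p"
  by (simp add: bv_metric_def Metric_space.mspace_metric Metric_space_bv)

lemma mdist_bv_metric: "1 \<le> p \<Longrightarrow> mdist (bv_metric p) = bv_dist p"
  by (simp add: bv_metric_def Metric_space.mdist_metric Metric_space_bv)

end

(* Uniform continuity forces linearity because arbitrarily long oscillations between two points u and v
   lie at bv_p distance norm w from their translates by w, whatever their length, whereas the bv_q
   distance of their images grows like N powr (1/q) times the norm of
   (f (u + w) - f u) - (f (v + w) - f v). So the increment of f along a short vector w does not depend
   on the base point; subdividing an arbitrary w, f - f 0 is additive, and it is continuous, hence
   real-linear. Conversely, a bounded linear map scales every bv_q norm by at most a constant, and the
   bv_q norm is dominated by the bv_p norm. *)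

theory Submission
  imports Defs
begin

section \<open>Comparison of \<open>bv\<close> norms across exponents and under linear maps\<close>

text \<open>Each term is bounded by the \<open>p\<close>-norm \<open>S\<close>, so one can trade
  \<open>q - p\<close> powers of it for powers of \<open>S\<close>; summing leaves
  \<open>S powr p * S powr (q - p) = S powr q\<close>.\<close>

lemma powr_suminf_antimono:
  fixes a :: "nat \<Rightarrow> real" and p q :: real
  assumes p: "0 < p" "p \<le> q" and a: "\<And>n. 0 \<le> a n" "summable (\<lambda>n. a n powr p)"
  shows "summable (\<lambda>n. a n powr q)"
    and "(\<Sum>n. a n powr q) powr (1 / q) \<le> (\<Sum>n. a n powr p) powr (1 / p)"
proof -
  define S where "S = (\<Sum>n. a n powr p) powr (1 / p)"
  have S0: "0 \<le> S"
    by (simp add: S_def)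
  have Sp: "S powr p = (\<Sum>n. a n powr p)"
    using p by (simp add: S_def powr_powr suminf_nonneg a)
  have "a n powr p \<le> S powr p" for n
    using sum_le_suminf[OF a(2), of "{n}"] by (simp add: Sp)
  then have aS: "a n \<le> S" for n
    using p a(1) S0 by (meson not_le powr_less_mono2)
  have le: "a n powr q \<le> a n powr p * S powr (q - p)" for n
  proof -
    \<comment> \<open>This covers \<open>a n = 0\<close> too, because \<open>0 powr r = 0\<close>
      for every \<open>r\<close>, including \<open>r = 0\<close>.\<close>
    have "a n powr q = a n powr p * a n powr (q - p)"
      by (simp flip: powr_add)
    also have "\<dots> \<le> a n powr p * S powr (q - p)"
      using p a(1) aS by (intro mult_left_mono powr_mono2) auto
    finally show ?thesis .
  qed
  have sums: "summable (\<lambda>n. a n powr p * S powr (q - p))"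
    by (intro summable_mult2 a)
  show s: "summable (\<lambda>n. a n powr q)"
    using le by (intro summable_comparison_test'[OF sums]) auto
  have "(\<Sum>n. a n powr q) \<le> (\<Sum>n. a n powr p * S powr (q - p))"
    by (rule suminf_le[OF le s sums])
  also have "\<dots> = S powr p * S powr (q - p)"
    by (simp add: suminf_mult2[OF a(2), symmetric] Sp)
  also have "\<dots> = S powr q"
    by (simp flip: powr_add)
  finally have "(\<Sum>n. a n powr q) powr (1 / q) \<le> (S powr q) powr (1 / q)"
    using p s by (intro powr_mono2 suminf_nonneg) auto
  also have "\<dots> = S"
    using p S0 by (simp add: powr_powr)
  finally show "(\<Sum>n. a n powr q) powr (1 / q) \<le> (\<Sum>n. a n powr p) powr (1 / p)"
    by (simp add: S_def)
qed

lemma bv_mono: "0 < p \<Longrightarrow> p \<le> q \<Longrightarrow> x \<in> bv p \<Longrightarrow> x \<in> bv q"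
  using powr_suminf_antimono(1)[of p q "\<lambda>n. norm (x (Suc n) - x n)"] by (simp add: bv_def)

lemma bv_norm_antimono: "0 < p \<Longrightarrow> p \<le> q \<Longrightarrow> x \<in> bv p \<Longrightarrow> bv_norm q x \<le> bv_norm p x"
  using powr_suminf_antimono(2)[of p q "\<lambda>n. norm (x (Suc n) - x n)"]
  by (simp add: bv_def bv_norm_def)

text \<open>Linearity turns the steps of the image sequence into images of the steps of
  \<open>z\<close>, so the bound by \<open>K\<close> applies term by term, and the factor
  \<open>K powr q\<close> leaves the root as \<open>K\<close>.\<close>

lemma bv_norm_bounded_linear_le:
  fixes g :: "'a::real_normed_vector \<Rightarrow> 'b::real_normed_vector"
  assumes q: "0 < q" and g: "linear g" "\<And>u. norm (g u) \<le> K * norm u" "0 \<le> K" and z: "z \<in> bv q"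
  shows "bv_norm q (\<lambda>n. g (z n)) \<le> K * bv_norm q z"
proof -
  define a where "a n = norm (z (Suc n) - z n)" for n
  have a: "summable (\<lambda>n. a n powr q)"
    using z by (simp add: bv_def a_def)
  have le: "norm (g (z (Suc n)) - g (z n)) powr q \<le> K powr q * a n powr q" for n
  proof -
    have "norm (g (z (Suc n)) - g (z n)) powr q \<le> (K * a n) powr q"
      using q g(2)[of "z (Suc n) - z n"]
      by (intro powr_mono2) (auto simp: linear_diff[OF g(1)] a_def)
    then show ?thesis
      using g(3) by (simp add: powr_mult a_def)
  qed
  have s: "summable (\<lambda>n. norm (g (z (Suc n)) - g (z n)) powr q)"
    using le by (intro summable_comparison_test'[OF summable_mult[OF a]]) auto
  have "(\<Sum>n. norm (g (z (Suc n)) - g (z n)) powr q) powr (1 / q)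
      \<le> (K powr q * (\<Sum>n. a n powr q)) powr (1 / q)"
    using q suminf_le[OF le s summable_mult[OF a]] suminf_mult[OF a, of "K powr q"]
    by (intro powr_mono2 suminf_nonneg[OF s]) auto
  also have "\<dots> = K * (\<Sum>n. a n powr q) powr (1 / q)"
    using q g(3) by (simp add: powr_mult powr_powr suminf_nonneg[OF a])
  finally show ?thesis
    using g(2)[of "z 0"] by (simp add: bv_norm_def a_def distrib_left)
qed

section \<open>Norm bounds and criteria for linearity\<close>

lemma linear_continuous_norm_bound:
  fixes g :: "'a::real_normed_vector \<Rightarrow> 'b::real_normed_vector"
  assumes g: "linear g" and c: "continuous (at 0) g"
  obtains K where "0 \<le> K" "\<And>u. norm (g u) \<le> K * norm u"
proof -
  have "\<exists>\<delta>>0. \<forall>u. dist u 0 < \<delta> \<longrightarrow> dist (g u) (g 0) < 1"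
    using c unfolding continuous_at_eps_delta by (metis zero_less_one)
  then obtain \<delta> where \<delta>: "\<delta> > 0" "\<And>u. norm u < \<delta> \<Longrightarrow> norm (g u) < 1"
    by (auto simp: linear_0[OF g])
  have "norm (g u) \<le> 2 / \<delta> * norm u" for u
  proof (cases "u = 0")
    case False
    \<comment> \<open>Rescaling \<open>u\<close> to norm \<open>\<delta> / 2\<close> puts it
      strictly inside the ball; the resulting bound is \<open>1 / t\<close>.\<close>
    define t where "t = \<delta> / (2 * norm u)"
    have t: "t > 0"
      using \<delta>(1) False by (simp add: t_def)
    have "norm (t *\<^sub>R u) < \<delta>"
      using \<delta>(1) False by (simp add: t_def)
    then have "t * norm (g u) < 1"
      using \<delta>(2)[of "t *\<^sub>R u"] t by (simp add: linear_scale[OF g])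
    then show ?thesis
      using \<delta>(1) False by (simp add: t_def field_simps)
  qed (simp add: linear_0[OF g])
  then show thesis
    using \<delta>(1) that[of "2 / \<delta>"] by simp
qed

text \<open>Additivity gives homogeneity for natural, integer and rational scalars in turn; density
  of the rationals and continuity extend it to real ones.\<close>

lemma additive_continuous_imp_linear:
  fixes g :: "'a::real_normed_vector \<Rightarrow> 'b::real_normed_vector"
  assumes add: "\<And>u v. g (u + v) = g u + g v" and c: "continuous_on UNIV g"
  shows "linear g"
proof
  interpret additive g
    by standard (rule add)
  have nat: "g (real n *\<^sub>R u) = real n *\<^sub>R g u" for n u
    by (induction n) (simp_all add: zero add scaleR_left_distrib)
  have int: "g (of_int k *\<^sub>R u) = of_int k *\<^sub>R g u" for k u
    \<comment> \<open>A negative integer appears as minus the cast of some \<open>Suc n\<close>;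
      keeping that cast intact lets \<open>nat\<close> apply.\<close>
    by (cases k) (simp_all add: nat minus add del: of_nat_Suc)
  fix r :: real and u :: 'a
  have rat: "g (s *\<^sub>R u) - s *\<^sub>R g u = 0" if s: "s \<in> \<rat>" for s
  proof -
    obtain k m where "m > 0" and s: "s = of_int k / of_int m"
      using s by (rule Rats_cases')
    \<comment> \<open>Clearing the denominator makes both sides equal to \<open>g\<close> at an
      integer multiple of \<open>u\<close>.\<close>
    then have "of_int m *\<^sub>R g (s *\<^sub>R u) = of_int m *\<^sub>R (s *\<^sub>R g u)"
      by (simp flip: int)
    then show ?thesis
      using \<open>m > 0\<close> by (simp only: scaleR_cancel_left) simp
  qed
  have "continuous_on (closure \<rat>) (\<lambda>s. g (s *\<^sub>R u) - s *\<^sub>R g u)"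
    by (intro continuous_intros continuous_on_compose2[OF c]) auto
  from continuous_constant_on_closure[OF this rat, of r] show "g (r *\<^sub>R u) = r *\<^sub>R g u"
    by (simp add: Rats_closure_real)
qed (rule add)

text \<open>Cutting \<open>w\<close> into \<open>n\<close> equal pieces shorter than
  \<open>\<delta>\<close> writes its increment as a telescoping sum of short ones, each independent
  of the base point.\<close>

lemma increments_base_point_independent:
  fixes f :: "'a::real_normed_vector \<Rightarrow> 'b::ab_group_add"
  assumes "\<delta> > 0"
    and small: "\<And>u v w. norm w < \<delta> \<Longrightarrow> f (u + w) - f u = f (v + w) - f v"
  shows "f (u + w) - f u = f (v + w) - f v"
proof -
  obtain n where n: "norm w < real n * \<delta>"
    using reals_Archimedean3[OF \<open>\<delta> > 0\<close>] by blast
  then have "n > 0"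
    by (cases n) auto
  define w' where "w' = (1 / real n) *\<^sub>R w"
  have w': "norm w' < \<delta>"
    using n \<open>n > 0\<close> by (simp add: w'_def field_simps)
  have "f (u + real k *\<^sub>R w') - f u = f (v + real k *\<^sub>R w') - f v" for k
  proof (induction k)
    case (Suc k)
    let ?a = "u + real k *\<^sub>R w'" and ?b = "v + real k *\<^sub>R w'"
    have "f (?a + w') - f u = (f (?a + w') - f ?a) + (f ?a - f u)"
      by (simp add: algebra_simps)
    also have "\<dots> = (f (?b + w') - f ?b) + (f ?b - f v)"
      by (simp only: small[OF w', of ?a ?b] Suc)
    also have "\<dots> = f (?b + w') - f v"
      by (simp add: algebra_simps)
    finally show ?case
      by (simp add: scaleR_left_distrib ac_simps)
  qed simp
  from this[of n] show ?thesis
    using \<open>n > 0\<close> by (simp add: w'_def)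
qed

section \<open>Oscillating test sequences\<close>

text \<open>There are exactly \<open>2 * N + 1\<close> jumps, the last one from index
  \<open>2 * N\<close>; the constant tail puts the sequence in every \<open>bv p\<close> with
  \<open>0 < p\<close>.\<close>

definition zigzag :: "nat \<Rightarrow> 'a \<Rightarrow> 'a \<Rightarrow> nat \<Rightarrow> 'a" where
  "zigzag N u v n = (if n \<le> 2 * N \<and> even n then u else v)"

lemma composition_operator_zigzag:
  "composition_operator f (zigzag N u v) = zigzag N (f u) (f v)"
  by (auto simp: composition_operator_def zigzag_def)

lemma zigzag_diff:
  "(\<lambda>n. zigzag N u v n - zigzag N u' v' n) = zigzag N (u - u') (v - v' :: 'a::minus)"
  by (auto simp: zigzag_def)

lemma norm_zigzag_step:
  "norm (zigzag N u v (Suc n) - zigzag N u v n) =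
    (if n < 2 * N + 1 then norm (u - v :: 'a::real_normed_vector) else 0)"
proof (cases "n < 2 * N + 1")
  case True
  show ?thesis
  proof (cases "even n")
    case True
    with \<open>n < 2 * N + 1\<close> show ?thesis
      by (simp add: zigzag_def norm_minus_commute)
  next
    case False
    \<comment> \<open>Hence \<open>Suc n\<close> is still at most \<open>2 * N\<close>, and being
      even it takes the value \<open>u\<close>.\<close>
    then have "n \<noteq> 2 * N"
      by auto
    with False \<open>n < 2 * N + 1\<close> show ?thesis
      by (simp add: zigzag_def)
  qed
qed (simp add: zigzag_def)

lemma zigzag_sums:
  assumes "0 < p"
  shows "(\<lambda>n. norm (zigzag N u v (Suc n) - zigzag N u v n :: 'a::real_normed_vector) powr p) sums
    (real (2 * N + 1) * norm (u - v) powr p)"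
  using sums_finite[of "{..<2 * N + 1}"
      "\<lambda>n. norm (zigzag N u v (Suc n) - zigzag N u v n) powr p"] assms
  by (simp add: norm_zigzag_step)

lemma zigzag_in_bv: "0 < p \<Longrightarrow> zigzag N u v \<in> bv p"
  using sums_summable[OF zigzag_sums] by (auto simp: bv_def)

lemma bv_norm_zigzag:
  assumes "0 < p"
  shows "bv_norm p (zigzag N u v) =
    norm u + (real (2 * N + 1) * norm (u - v) powr p) powr (1 / p)"
  using sums_unique[OF zigzag_sums[OF assms, of N u v], symmetric]
  by (simp add: bv_norm_def zigzag_def)

text \<open>The difference is a zigzag between \<open>w\<close> and \<open>w\<close>, that is, a
  constant sequence: only its first term counts, and \<open>N\<close> drops out.\<close>

lemma bv_dist_zigzag_translate:
  assumes "0 < p"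
  shows "bv_dist p (zigzag N (u + w) (v + w)) (zigzag N u v) = norm w"
  using assms by (simp add: bv_dist_def zigzag_diff bv_norm_zigzag)

text \<open>Jumps of positive height, repeated often enough, have total \<open>q\<close>-variation
  above 1, so a bound uniform in \<open>N\<close> forces height zero.\<close>

lemma small_bv_norm_zigzag_imp_eq:
  assumes q: "0 < q" and less: "\<And>N. bv_norm q (zigzag N a b) < 1"
  shows "a = b"
proof (rule ccontr)
  assume "a \<noteq> b"
  then have "norm (a - b) powr q > 0"
    by simp
  then obtain N where N: "1 < real N * norm (a - b) powr q"
    using reals_Archimedean3 by blast
  also have "\<dots> \<le> real (2 * N + 1) * norm (a - b) powr q"
    by (intro mult_right_mono) auto
  finally have "1 \<le> (real (2 * N + 1) * norm (a - b) powr q) powr (1 / q)"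
    using q by (intro ge_one_powr_ge_zero) auto
  then show False
    using less[of N] norm_ge_zero[of a] unfolding bv_norm_zigzag[OF q] by linarith
qed

section \<open>The implications between uniform continuity, linearity and Lipschitz
  continuity\<close>

lemma uniformly_continuous_imp_linear:
  fixes f :: "'a::real_normed_vector \<Rightarrow> 'a"
  assumes p: "1 \<le> p" and q: "1 \<le> q"
    and uc: "uniformly_continuous_map (bv_metric p) (bv_metric q) (composition_operator f)"
  shows "linear (\<lambda>u. f u - f 0)" and "continuous_on UNIV (\<lambda>u. f u - f 0)"
proof -
  \<comment> \<open>The order of quantifiers is the point: one \<open>\<delta>\<close> serves all
    base points and all lengths \<open>N\<close>, since the translates stay at distance
    \<open>norm w\<close>.\<close>
  have key: "\<exists>\<delta>>0. \<forall>N u v w. norm w < \<delta> \<longrightarrow>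
      bv_norm q (zigzag N (f (u + w) - f u) (f (v + w) - f v)) < \<epsilon>" if "\<epsilon> > 0" for \<epsilon>
  proof -
    obtain \<delta> where \<delta>: "\<delta> > 0" "\<And>x y. x \<in> bv p \<Longrightarrow> y \<in> bv p \<Longrightarrow> bv_dist p y x < \<delta> \<Longrightarrow>
        bv_dist q (composition_operator f y) (composition_operator f x) < \<epsilon>"
      using uc \<open>\<epsilon> > 0\<close> p q
      unfolding uniformly_continuous_map_def mspace_bv_metric[OF p] mdist_bv_metric[OF p]
        mdist_bv_metric[OF q] by meson
    have "bv_norm q (zigzag N (f (u + w) - f u) (f (v + w) - f v)) < \<epsilon>" if "norm w < \<delta>" for N u v w
    proof -
      have "bv_dist q (composition_operator f (zigzag N (u + w) (v + w)))
          (composition_operator f (zigzag N u v)) < \<epsilon>"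
        using p that by (intro \<delta>(2) zigzag_in_bv) (simp_all add: bv_dist_zigzag_translate)
      then show ?thesis
        by (simp add: composition_operator_zigzag bv_dist_def zigzag_diff)
    qed
    with \<delta>(1) show ?thesis
      by blast
  qed
  show cont: "continuous_on UNIV (\<lambda>u. f u - f 0)"
    unfolding continuous_on_iff
  proof (intro ballI allI impI)
    fix u :: 'a and \<epsilon> :: real
    assume "\<epsilon> > 0"
    then obtain \<delta> where \<delta>: "\<delta> > 0" "\<And>N u v w. norm w < \<delta> \<Longrightarrow>
        bv_norm q (zigzag N (f (u + w) - f u) (f (v + w) - f v)) < \<epsilon>"
      using key by meson
    have "dist (f v) (f u) < \<epsilon>" if "dist v u < \<delta>" for v
      \<comment> \<open>With equal base points the zigzag is constant, so its norm is just
        \<open>norm (f v - f u)\<close>; the length 0 is an arbitrary choice.\<close>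
      using \<delta>(2)[of "v - u" 0 u u] that q by (simp add: bv_norm_zigzag dist_norm)
    then show "\<exists>\<delta>>0. \<forall>v\<in>UNIV. dist v u < \<delta> \<longrightarrow> dist (f v - f 0) (f u - f 0) < \<epsilon>"
      using \<delta>(1) by (auto simp: dist_norm)
  qed
  obtain \<delta> where \<delta>: "\<delta> > 0" "\<And>N u v w. norm w < \<delta> \<Longrightarrow>
      bv_norm q (zigzag N (f (u + w) - f u) (f (v + w) - f v)) < 1"
    using key[of 1] by (meson zero_less_one)
  have "f (u + w) - f u = f (v + w) - f v" if "norm w < \<delta>" for u v w
    using q \<delta>(2)[OF that] by (intro small_bv_norm_zigzag_imp_eq[of q]) auto
  \<comment> \<open>Comparing with the base point 0 turns independence of the base point into
    additivity.\<close>
  then have "f (u + w) - f u = f (0 + w) - f 0" for u w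
    by (rule increments_base_point_independent[OF \<delta>(1)])
  then have "f (u + w) - f 0 = (f u - f 0) + (f w - f 0)" for u w
    by (simp add: algebra_simps)
  then show "linear (\<lambda>u. f u - f 0)"
    by (rule additive_continuous_imp_linear[OF _ cont])
qed

text \<open>A norm bound \<open>K\<close> for the linear part of \<open>f\<close> serves as
  Lipschitz constant: it is applied within \<open>bv q\<close>, and the \<open>bv\<close> norm then
  only grows on passing from \<open>q\<close> to \<open>p\<close>.\<close>

lemma linear_imp_Lipschitz_continuous:
  fixes f :: "'a::real_normed_vector \<Rightarrow> 'a"
  assumes p: "1 \<le> p" "p \<le> q"
    and C: "composition_operator f \<in> bv p \<rightarrow> bv q"
    and lin: "linear (\<lambda>u. f u - f 0)" and cont: "continuous_on UNIV (\<lambda>u. f u - f 0)"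
  shows "Lipschitz_continuous_map (bv_metric p) (bv_metric q) (composition_operator f)"
proof -
  have q: "1 \<le> q" "0 < p" "0 < q"
    using p by auto
  obtain K where K: "0 \<le> K" "\<And>u. norm (f u - f 0) \<le> K * norm u"
    using linear_continuous_norm_bound[OF lin] cont
    by (metis continuous_on_eq_continuous_at open_UNIV UNIV_I)
  have "bv_dist q (composition_operator f x) (composition_operator f y) \<le> K * bv_dist p x y"
    if x: "x \<in> bv p" and y: "y \<in> bv p" for x y
  proof -
    note z = bv_diff[OF p(1) x y]
    \<comment> \<open>The constant \<open>f 0\<close> cancels in the difference, which leaves the
      linear part at \<open>x n - y n\<close>.\<close>
    have "f (x n) - f (y n) = f (x n - y n) - f 0" for n
      using linear_diff[OF lin, of "x n" "y n"] by simp
    then have "bv_dist q (composition_operator f x) (composition_operator f y)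
        = bv_norm q (\<lambda>n. f (x n - y n) - f 0)"
      by (simp add: bv_dist_def composition_operator_def)
    also have "\<dots> \<le> K * bv_norm q (\<lambda>n. x n - y n)"
      by (rule bv_norm_bounded_linear_le[OF q(3) lin K(2,1) bv_mono[OF q(2) p(2) z]])
    also have "\<dots> \<le> K * bv_dist p x y"
      unfolding bv_dist_def by (intro mult_left_mono bv_norm_antimono q p z K)
    finally show ?thesis .
  qed
  then show ?thesis
    using C unfolding Lipschitz_continuous_map_def mspace_bv_metric[OF p(1)]
      mspace_bv_metric[OF q(1)] mdist_bv_metric[OF p(1)] mdist_bv_metric[OF q(1)]
    by blast
qed

theorem theorem27:
  fixes f :: "'a::real_normed_vector \<Rightarrow> 'a" and p q :: real
  assumes "1 \<le> p" and "p \<le> q"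
    and "p = 1 \<Longrightarrow> complete (UNIV :: 'a set)"
    and "composition_operator f \<in> bv p \<rightarrow> bv q"
  defines "\<phi> \<equiv> \<lambda>u. f u - f 0"
  shows "(Lipschitz_continuous_map (bv_metric p) (bv_metric q) (composition_operator f)
            \<longleftrightarrow> uniformly_continuous_map (bv_metric p) (bv_metric q) (composition_operator f))
       \<and> (uniformly_continuous_map (bv_metric p) (bv_metric q) (composition_operator f)
            \<longleftrightarrow> linear \<phi> \<and> continuous_on UNIV \<phi>)"
proof -
  have "1 \<le> q"
    using assms(1,2) by simp
  then show ?thesis
    unfolding \<phi>_def
    \<comment> \<open>The conditions are linked in a cycle: Lipschitz to uniformly continuous to
      linear and continuous, and back to Lipschitz.\<close>
    using uniformly_continuous_imp_linear[OF assms(1)] Lipschitz_imp_uniformly_continuous_map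
      linear_imp_Lipschitz_continuous[OF assms(1,2,4)] by blast
qed

end
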